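(* Let $d\ge1$ and $\lambda\ge 1$. The map $\Phi_\lambda\colon \mathrm{SE}(d)\to \mathrm{SO}(d+1)$, which sends $\begin{bmatrix}\mu & b\\ \mathbf{0}_{1\times d}&1\end{bmatrix}$ to the orthogonal factor $U_\lambda$ of the polar decomposition $g_\lambda=U_\lambda H_\lambda$ of $g_\lambda=\begin{bmatrix}\mu & b/\lambda\\ \mathbf{0}_{1\times d}&1\end{bmatrix}$, is injective.
   Context: Elements of the special Euclidean group $\mathrm{SE}(d)=\mathrm{SO}(d)\ltimes\mathbb{R}^d$ are identified with the matrices $\begin{bmatrix}\mu & b\\ \mathbf{0}_{1\times d}&1\end{bmatrix}$, $\mu\in\mathrm{SO}(d)$, $b\in\mathbb{R}^d$. In the polar decomposition $g_\lambda=U_\lambda H_\lambda$, $U_\lambda$ is orthogonal and $H_\lambda$ is symmetric positive definite. *)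

theory Defs
  imports "HOL-Analysis.Analysis"
begin

text \<open>
  Square matrices of size \<open>d + 1\<close> are indexed by the sum type \<^typ>\<open>'d + 1\<close>:
  \<open>Inl i\<close> are the first \<open>d\<close> indices and \<open>Inr 1\<close> is the last one.
\<close>

definition homogeneous_matrix :: "real^'d^'d \<Rightarrow> real^'d \<Rightarrow> real^('d::finite + 1)^('d + 1)" where
  "homogeneous_matrix \<mu> b = (\<chi> i j. case (i, j) of
       (Inl k, Inl l) \<Rightarrow> \<mu> $ k $ l
     | (Inl k, Inr _) \<Rightarrow> b $ k
     | (Inr _, Inl _) \<Rightarrow> 0
     | (Inr _, Inr _) \<Rightarrow> 1)"

definition linear_part :: "real^('d::finite + 1)^('d + 1) \<Rightarrow> real^'d^'d" where
  "linear_part g = (\<chi> i j. g $ Inl i $ Inl j)"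

definition translation_part :: "real^('d::finite + 1)^('d + 1) \<Rightarrow> real^'d" where
  "translation_part g = (\<chi> i. g $ Inl i $ Inr 1)"

lemma linear_part_homogeneous_matrix [simp]:
  "linear_part (homogeneous_matrix \<mu> b) = \<mu>"
  by (simp add: linear_part_def homogeneous_matrix_def vec_eq_iff)

lemma translation_part_homogeneous_matrix [simp]:
  "translation_part (homogeneous_matrix \<mu> b) = b"
  by (simp add: translation_part_def homogeneous_matrix_def vec_eq_iff)

definition special_orthogonal_group :: "(real^'n^'n) set" where
  "special_orthogonal_group = {Q. rotation_matrix Q}"

definition special_euclidean_group :: "(real^('d::finite + 1)^('d + 1)) set" where
  "special_euclidean_group =
     {homogeneous_matrix \<mu> b | (\<mu> :: real^'d^'d) b. \<mu> \<in> special_orthogonal_group}"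

definition symmetric_positive_definite :: "real^'n^'n \<Rightarrow> bool" where
  "symmetric_positive_definite H \<longleftrightarrow>
     transpose H = H \<and> (\<forall>x. x \<noteq> 0 \<longrightarrow> x \<bullet> (H *v x) > 0)"

definition polar_decomposition :: "real^'n^'n \<Rightarrow> real^'n^'n \<Rightarrow> real^'n^'n \<Rightarrow> bool" where
  "polar_decomposition A U H \<longleftrightarrow>
     orthogonal_matrix U \<and> symmetric_positive_definite H \<and> A = U ** H"

text \<open>Meaningful for invertible matrices, which have exactly one polar decomposition.\<close>

definition orthogonal_polar_factor :: "real^'n^'n \<Rightarrow> real^'n^'n" where
  "orthogonal_polar_factor A = (THE U. \<exists>H. polar_decomposition A U H)"

definition scaled_motion :: "real \<Rightarrow> real^('d::finite + 1)^('d + 1) \<Rightarrow> real^('d + 1)^('d + 1)" where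
  "scaled_motion lam g = homogeneous_matrix (linear_part g) (translation_part g /\<^sub>R lam)"

definition polar_map :: "real \<Rightarrow> real^('d::finite + 1)^('d + 1) \<Rightarrow> real^('d + 1)^('d + 1)" where
  "polar_map lam g = orthogonal_polar_factor (scaled_motion lam g)"

end

theory Submission
  imports Defs
begin

text \<open>
  Put \<open>c = b / \<lambda>\<close>. Then \<open>g\<^sub>\<lambda>\<close> is the translation by \<open>c\<close> times the rotation by \<open>\<mu>\<close>, and the polar
  factors of the translation are explicit: it acts as a shear of one plane. If \<open>W c\<close> is its
  orthogonal factor, then the orthogonal factor of \<open>g\<^sub>\<lambda>\<close> is \<open>W c\<close> times the rotation by \<open>\<mu>\<close>. The
  rotation fixes the last coordinate axis, so the last column of the product is that of \<open>W c\<close>. It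
  determines \<open>c\<close>, and cancelling \<open>W c\<close> gives \<open>\<mu>\<close>.
\<close>

section \<open>Positive definite matrices and uniqueness of the polar decomposition\<close>

lemma matrix_diff_ldistrib:
  fixes A :: "real^'n^'m" and B C :: "real^'k^'n"
  shows "A ** (B - C) = A ** B - A ** C"
  by (simp add: matrix_eq matrix_vector_mul_assoc [symmetric] algebra_simps)

lemma matrix_diff_rdistrib:
  fixes A B :: "real^'n^'m" and C :: "real^'k^'n"
  shows "(A - B) ** C = A ** C - B ** C"
  by (simp add: matrix_eq matrix_vector_mul_assoc [symmetric] algebra_simps)

lemma transpose_diff:
  fixes A B :: "real^'n^'m"
  shows "transpose (A - B) = transpose A - transpose B"
  by (simp add: transpose_def vec_eq_iff)

lemma symmetric_positive_definite_det_nz: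
  fixes H :: "real^'n^'n"
  assumes "symmetric_positive_definite H"
  shows "det H \<noteq> 0"
proof -
  have "H *v x \<noteq> 0" if "x \<noteq> 0" for x
    using assms that by (force simp: symmetric_positive_definite_def)
  then have "\<exists>B. B ** H = mat 1"
    using matrix_left_invertible_ker by blast
  then show ?thesis
    by (metis det_I det_mul mult_zero_right zero_neq_one)
qed

text \<open>The segment from the identity to \<open>H\<close> stays positive definite, so the
  determinant has no zero on it and keeps the sign it has at the identity.\<close>

lemma symmetric_positive_definite_det_pos:
  fixes H :: "real^'n^'n"
  assumes "symmetric_positive_definite H"
  shows "det H > 0"
proof (rule ccontr)
  define p where "p t = (1 - t) *\<^sub>R mat 1 + t *\<^sub>R H" for t :: real
  assume "\<not> det H > 0"
  then have "det (p 1) \<le> 0" "det (p 0) \<ge> 0"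
    by (simp_all add: p_def)
  moreover have "continuous_on {0..1} (\<lambda>t. det (p t))"
    unfolding det_def p_def by (auto intro!: continuous_intros)
  ultimately obtain t where t: "0 \<le> t" "t \<le> 1" "det (p t) = 0"
    using IVT2' [of "\<lambda>t. det (p t)" 1 0 0] by auto
  have "symmetric_positive_definite (p t)"
    unfolding symmetric_positive_definite_def
  proof (intro conjI allI impI)
    have "transpose H = H"
      using assms by (simp add: symmetric_positive_definite_def)
    then show "transpose (p t) = p t"
      by (auto simp: p_def transpose_def vec_eq_iff mat_def)
    fix x :: "real^'n"
    assume "x \<noteq> 0"
    then have "x \<bullet> x > 0" "x \<bullet> (H *v x) > 0"
      using assms by (auto simp: symmetric_positive_definite_def)
    moreover have "x \<bullet> (p t *v x) = (1 - t) * (x \<bullet> x) + t * (x \<bullet> (H *v x))"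
      by (simp add: p_def matrix_vector_mult_add_rdistrib scaleR_matrix_vector_assoc [symmetric]
          inner_add_right)
    \<comment> \<open>For \<open>t = 0\<close> the first summand is positive; otherwise the second
      is, and the first is nonnegative.\<close>
    ultimately show "x \<bullet> (p t *v x) > 0"
      using t by (cases "t = 0") (auto intro: add_nonneg_pos)
  qed
  then show False
    using t symmetric_positive_definite_det_nz by blast
qed

text \<open>The form of the new matrix at \<open>x\<close> is the form of \<open>H\<close> at
  \<open>R *v x\<close>, and \<open>R\<close> has trivial kernel.\<close>

lemma symmetric_positive_definite_congruence:
  fixes H R :: "real^'n^'n"
  assumes "symmetric_positive_definite H" "orthogonal_matrix R"
  shows "symmetric_positive_definite (transpose R ** H ** R)"
  unfolding symmetric_positive_definite_def
proof (intro conjI allI impI)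
  show "transpose (transpose R ** H ** R) = transpose R ** H ** R"
    using assms by (simp add: symmetric_positive_definite_def matrix_transpose_mul matrix_mul_assoc)
  fix x :: "real^'n"
  assume "x \<noteq> 0"
  then have "R *v x \<noteq> 0"
    by (metis assms(2) matrix_vector_mul_assoc matrix_vector_mul_lid matrix_vector_mult_0_right
        orthogonal_matrix)
  then have "(R *v x) \<bullet> (H *v (R *v x)) > 0"
    using assms by (simp add: symmetric_positive_definite_def)
  also have "(R *v x) \<bullet> (H *v (R *v x)) = x \<bullet> ((transpose R ** H ** R) *v x)"
    by (metis dot_lmul_matrix inner_commute matrix_vector_mul_assoc transpose_matrix_vector)
  finally show "x \<bullet> ((transpose R ** H ** R) *v x) > 0" .
qed

text \<open>Links traces to positivity: a vanishing diagonal forces every column of \<open>D\<close>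
  to be zero when \<open>H\<close> is positive definite.\<close>

lemma diagonal_congruence:
  fixes H D :: "real^'n^'n"
  shows "(transpose D ** H ** D) $ i $ i = column i D \<bullet> (H *v column i D)"
proof -
  have "(transpose D ** H ** D) $ i $ i = axis i 1 \<bullet> ((transpose D ** H ** D) *v axis i 1)"
    by (simp add: inner_axis' matrix_vector_mult_basis column_def)
  also have "(transpose D ** H ** D) *v axis i 1 = transpose D *v (H *v column i D)"
    by (metis matrix_vector_mul_assoc matrix_vector_mult_basis)
  also have "axis i 1 \<bullet> \<dots> = (D *v axis i 1) \<bullet> (H *v column i D)"
    by (metis dot_lmul_matrix inner_commute transpose_matrix_vector)
  finally show ?thesis
    by (simp add: matrix_vector_mult_basis)
qed

text \<open>With \<open>D = H - K\<close> one has \<open>H D + D K = H\<^sup>2 - K\<^sup>2 = 0\<close>; multiplying by \<open>D\<close> and taking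
  traces, the nonnegative numbers \<open>tr (D H D)\<close> and \<open>tr (D K D)\<close> add up to zero.\<close>

lemma symmetric_positive_definite_sqrt_unique:
  fixes H K :: "real^'n^'n"
  assumes H: "symmetric_positive_definite H" and K: "symmetric_positive_definite K"
    and eq: "H ** H = K ** K"
  shows "H = K"
proof -
  define D where "D = H - K"
  have sym: "transpose D = D"
    using H K by (simp add: D_def transpose_diff symmetric_positive_definite_def)
  have nonneg: "(D ** M ** D) $ i $ i \<ge> 0" if "symmetric_positive_definite M" for M i
    using diagonal_congruence [of D M i] that unfolding sym
    by (cases "column i D = 0") (auto simp: symmetric_positive_definite_def less_imp_le)
  have "H ** D + D ** K = 0"
    by (simp add: D_def matrix_diff_ldistrib matrix_diff_rdistrib eq)
  then have "D ** H ** D + D ** D ** K = 0"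
    by (metis add.right_neutral add_left_cancel matrix_add_ldistrib matrix_mul_assoc)
  then have "trace (D ** H ** D) + trace (D ** D ** K) = 0"
    by (metis mat_0 trace_0 trace_add)
  \<comment> \<open>Cyclicity of the trace moves \<open>K\<close> between the two factors
    \<open>D\<close>, which makes the diagonal entries nonnegative.\<close>
  moreover have "trace (D ** D ** K) = trace (D ** K ** D)"
    by (metis matrix_mul_assoc trace_mul_sym)
  ultimately have "trace (D ** H ** D) \<le> 0"
    using nonneg [OF K] by (simp add: trace_def) (smt (verit) sum_nonneg)
  then have "trace (D ** H ** D) = 0"
    using nonneg [OF H] unfolding trace_def by (meson order_antisym sum_nonneg)
  then have "(D ** H ** D) $ i $ i = 0" for i
    using nonneg [OF H] by (simp add: trace_def sum_nonneg_eq_0_iff)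
  then have "column i D = 0" for i
    using diagonal_congruence [of D H i] H unfolding sym
    by (metis less_irrefl symmetric_positive_definite_def)
  then show ?thesis
    by (simp add: D_def column_def vec_eq_iff)
qed

text \<open>The orthogonal factor drops out of \<open>transpose A ** A\<close>, which is thus the
  square of either stretch. Uniqueness of the positive square root identifies the stretches, and an
  invertible stretch can be cancelled.\<close>

lemma polar_decomposition_unique:
  fixes A :: "real^'n^'n"
  assumes U: "polar_decomposition A U H" and V: "polar_decomposition A V K"
  shows "U = V"
proof -
  have square: "transpose A ** A = M ** M" if "polar_decomposition A Q M" for Q M
  proof -
    have "transpose A ** A = transpose M ** (transpose Q ** Q) ** M"
      using that by (simp add: polar_decomposition_def matrix_transpose_mul matrix_mul_assoc)
    then show ?thesis
      using that
      by (simp add: polar_decomposition_def orthogonal_matrix symmetric_positive_definite_def)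
  qed
  have "H = K"
    using U V square [OF U] square [OF V]
    by (auto simp: polar_decomposition_def intro: symmetric_positive_definite_sqrt_unique)
  then have "U ** H = V ** H"
    using U V by (simp add: polar_decomposition_def)
  moreover obtain B where "H ** B = mat 1"
    using symmetric_positive_definite_det_nz [of H] U
    by (auto simp: polar_decomposition_def invertible_det_nz [symmetric] invertible_def)
  ultimately show ?thesis
    by (metis matrix_mul_assoc matrix_mul_rid)
qed

text \<open>By uniqueness, exhibiting any polar decomposition evaluates the definite
  description.\<close>

lemma orthogonal_polar_factor_eqI:
  "polar_decomposition A U H \<Longrightarrow> orthogonal_polar_factor A = U"
  unfolding orthogonal_polar_factor_def
  by (rule the_equality) (auto intro: polar_decomposition_unique)

text \<open>The stretch has positive determinant, so \<open>det U\<close> has the sign of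
  \<open>det A\<close>, and it is 1 or -1.\<close>

lemma polar_decomposition_rotation_matrix:
  fixes A :: "real^'n^'n"
  assumes "polar_decomposition A U H" "det A > 0"
  shows "rotation_matrix U"
proof -
  have "det A = det U * det H" "det H > 0"
    using assms by (auto simp: polar_decomposition_def det_mul symmetric_positive_definite_det_pos)
  then have "det U > 0"
    using assms(2) by (simp add: zero_less_mult_iff)
  then show ?thesis
    using assms det_orthogonal_matrix [of U]
    by (auto simp: polar_decomposition_def rotation_matrix_def)
qed

text \<open>Insert \<open>R ** transpose R\<close> between \<open>U\<close> and
  \<open>H\<close>.\<close>

lemma polar_decomposition_mult_orthogonal:
  fixes A :: "real^'n^'n"
  assumes "polar_decomposition A U H" "orthogonal_matrix R"
  shows "polar_decomposition (A ** R) (U ** R) (transpose R ** H ** R)"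
proof -
  have "U ** R ** (transpose R ** H ** R) = U ** (R ** transpose R) ** H ** R"
    by (simp add: matrix_mul_assoc)
  also have "\<dots> = A ** R"
    using assms by (simp add: polar_decomposition_def orthogonal_matrix_def)
  finally show ?thesis
    using assms
    by (simp add: polar_decomposition_def orthogonal_matrix_mul symmetric_positive_definite_congruence)
qed

section \<open>Block coordinates in dimension d + 1\<close>

definition block_vector :: "real^'d \<Rightarrow> real \<Rightarrow> real^('d::finite + 1)" where
  "block_vector v t = (\<chi> i. case i of Inl k \<Rightarrow> v $ k | Inr _ \<Rightarrow> t)"

definition block_matrix ::
    "real^'d^'d \<Rightarrow> real^'d \<Rightarrow> real^'d \<Rightarrow> real \<Rightarrow> real^('d::finite + 1)^('d + 1)" where
  "block_matrix A b c a = (\<chi> i. case i of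
       Inl k \<Rightarrow> block_vector (A $ k) (b $ k)
     | Inr _ \<Rightarrow> block_vector c a)"

lemma homogeneous_matrix_eq_block_matrix: "homogeneous_matrix A b = block_matrix A b 0 1"
  by (auto simp: homogeneous_matrix_def block_matrix_def block_vector_def vec_eq_iff
      split: sum.split)

lemma all_sum_one: "(\<forall>i :: 'd + 1. P i) \<longleftrightarrow> (\<forall>k. P (Inl k)) \<and> P (Inr 1)"
  by (metis (full_types) num1_eq1 obj_sumE)

lemma block_vector_eq_iff: "block_vector v t = block_vector w u \<longleftrightarrow> v = w \<and> t = u"
  by (simp add: block_vector_def vec_eq_iff all_sum_one)

lemma block_vector_cases:
  fixes x :: "real^('d::finite + 1)"
  obtains v t where "x = block_vector v t"
proof
  show "x = block_vector (\<chi> k. x $ Inl k) (x $ Inr 1)"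
    by (simp add: block_vector_def vec_eq_iff all_sum_one)
qed

lemma sum_UNIV_sum_one:
  fixes f :: "'d::finite + 1 \<Rightarrow> real"
  shows "(\<Sum>i\<in>UNIV. f i) = (\<Sum>k\<in>UNIV. f (Inl k)) + f (Inr 1)"
  by (simp add: UNIV_Plus_UNIV [symmetric] sum.Plus del: UNIV_Plus_UNIV)

lemma prod_UNIV_sum_one:
  fixes f :: "'d::finite + 1 \<Rightarrow> real"
  shows "(\<Prod>i\<in>UNIV. f i) = (\<Prod>k\<in>UNIV. f (Inl k)) * f (Inr 1)"
  by (simp add: UNIV_Plus_UNIV [symmetric] prod.Plus del: UNIV_Plus_UNIV)

lemma inner_block_vector: "block_vector v t \<bullet> block_vector w u = v \<bullet> w + t * u"
  by (simp add: inner_vec_def sum_UNIV_sum_one block_vector_def)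

lemma block_vector_eq_0_iff: "block_vector v t = 0 \<longleftrightarrow> v = 0 \<and> t = 0"
  by (simp add: block_vector_def vec_eq_iff all_sum_one)

lemma block_matrix_mult_vector:
  "block_matrix A b c a *v block_vector v t =
     block_vector (A *v v + t *\<^sub>R b) (c \<bullet> v + a * t)"
  by (simp add: matrix_mult_dot vec_eq_iff all_sum_one)
     (simp add: block_matrix_def inner_block_vector, simp add: block_vector_def matrix_mult_dot)

lemma transpose_block_matrix:
  "transpose (block_matrix A b c a) = block_matrix (transpose A) c b a"
  by (simp add: vec_eq_iff all_sum_one transpose_def block_matrix_def block_vector_def)

text \<open>Allows matrix identities to be checked through the action on block vectors instead of
  entry by entry.\<close>

lemma matrix_eq_block_vectorI:
  fixes A B :: "real^('d::finite + 1)^('d + 1)"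
  assumes "\<And>v t. A *v block_vector v t = B *v block_vector v t"
  shows "A = B"
  unfolding matrix_eq by (metis assms block_vector_cases)

lemma homogeneous_matrix_mult:
  "homogeneous_matrix A b ** homogeneous_matrix A' b' = homogeneous_matrix (A ** A') (A *v b' + b)"
  by (rule matrix_eq_block_vectorI)
     (simp add: homogeneous_matrix_eq_block_matrix matrix_vector_mul_assoc [symmetric]
       block_matrix_mult_vector algebra_simps)

lemma homogeneous_matrix_one: "homogeneous_matrix (mat 1) 0 = mat 1"
  by (rule matrix_eq_block_vectorI)
     (simp add: homogeneous_matrix_eq_block_matrix block_matrix_mult_vector)

lemma orthogonal_homogeneous_matrix:
  assumes "orthogonal_matrix R"
  shows "orthogonal_matrix (homogeneous_matrix R 0)"
proof -
  have "transpose (homogeneous_matrix R 0) = homogeneous_matrix (transpose R) 0"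
    by (simp add: homogeneous_matrix_eq_block_matrix transpose_block_matrix)
  then show ?thesis
    using assms by (simp add: orthogonal_matrix homogeneous_matrix_mult homogeneous_matrix_one)
qed

section \<open>Determinants of homogeneous matrices\<close>

lemma det_swap_matrix:
  assumes "m \<noteq> n"
  shows "det (\<chi> i j. mat 1 $ i $ Transposition.transpose m n j :: real^'n^'n) = - 1"
  using assms det_permute_columns [of "Transposition.transpose m n" "mat 1 :: real^'n^'n"]
  by (simp add: permutes_swap_id sign_swap_id)

lemma det_transvection:
  assumes "m \<noteq> n"
  shows "det (\<chi> i j. of_bool (i = m \<and> j = n \<or> i = j) :: real^'n^'n) = 1"
proof -
  have "(\<chi> i j. of_bool (i = m \<and> j = n \<or> i = j) :: real^'n^'n) =
      (\<chi> k. if k = m then row m (mat 1) + 1 *s row n (mat 1) else row k (mat 1))"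
    using assms by (auto simp: vec_eq_iff row_def mat_def)
  then show ?thesis
    using det_row_operation [OF assms, of "mat 1 :: real^'n^'n" 1] by simp
qed

text \<open>Both sides are multiplicative in \<open>A\<close>, so it suffices to treat matrices with
  a zero row, diagonal matrices, swaps and transvections. The block embedding sends each kind to the
  same kind.\<close>

lemma det_homogeneous_matrix_0: "det (homogeneous_matrix A 0) = det A"
proof (induction A rule: induct_matrix_elementary_alt)
  case (1 A B)
  have "homogeneous_matrix (A ** B) 0 = homogeneous_matrix A 0 ** homogeneous_matrix B 0"
    by (simp add: homogeneous_matrix_mult)
  with 1 show ?case
    by (simp add: det_mul)
next
  case (2 A i)
  then have "row (Inl i) (homogeneous_matrix A 0) = 0"
    by (auto simp: vec_eq_iff row_def homogeneous_matrix_def split: sum.split)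
  with 2 show ?case
    by (simp add: det_zero_row)
next
  case (3 A)
  then have "homogeneous_matrix A 0 $ i $ j = 0" if "i \<noteq> j" for i j
    using that by (auto simp: homogeneous_matrix_def split: sum.split)
  then have "det (homogeneous_matrix A 0) = (\<Prod>i\<in>UNIV. homogeneous_matrix A 0 $ i $ i)"
    by (rule det_diagonal)
  also have "\<dots> = (\<Prod>i\<in>UNIV. A $ i $ i)"
    by (simp add: prod_UNIV_sum_one homogeneous_matrix_def)
  finally show ?case
    using 3 by (simp add: det_diagonal)
next
  case (4 m n)
  have "homogeneous_matrix (\<chi> i j. mat 1 $ i $ Transposition.transpose m n j) 0 =
      (\<chi> i j. mat 1 $ i $ Transposition.transpose (Inl m) (Inl n) j)"
    by (simp add: vec_eq_iff all_sum_one homogeneous_matrix_def mat_def Transposition.transpose_def)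
  with 4 show ?case
    by (simp add: det_swap_matrix)
next
  case (5 m n)
  have "homogeneous_matrix (\<chi> i j. of_bool (i = m \<and> j = n \<or> i = j)) 0 =
      (\<chi> i j. of_bool (i = Inl m \<and> j = Inl n \<or> i = j))"
    by (simp add: vec_eq_iff all_sum_one homogeneous_matrix_def)
  with 5 show ?case
    using det_transvection [of m n] det_transvection [of "Inl m :: 'a + 1" "Inl n"] by simp
qed

text \<open>The translation by \<open>b\<close> is the square of the translation by
  \<open>b / 2\<close>, so its determinant is a nonzero square.\<close>

lemma det_homogeneous_matrix_pos:
  assumes "det A > 0"
  shows "det (homogeneous_matrix A b) > 0"
proof -
  let ?S = "homogeneous_matrix (mat 1) (b /\<^sub>R 2)" and ?S' = "homogeneous_matrix (mat 1) (- (b /\<^sub>R 2))"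
  have "?S ** ?S' = mat 1"
    by (simp add: homogeneous_matrix_mult homogeneous_matrix_one)
  then have "det ?S \<noteq> 0"
    by (metis det_I det_mul mult_zero_left zero_neq_one)
  moreover have "homogeneous_matrix A b = ?S ** ?S ** homogeneous_matrix A 0"
    by (simp add: homogeneous_matrix_mult flip: scaleR_add_left)
  then have "det (homogeneous_matrix A b) = (det ?S)\<^sup>2 * det A"
    by (simp add: det_mul det_homogeneous_matrix_0 power2_eq_square)
  ultimately show ?thesis
    using assms by simp
qed

section \<open>Explicit polar decomposition of a translation\<close>

definition rank_one :: "real^'n \<Rightarrow> real^'n^'n" where
  "rank_one c = (\<chi> i j. c $ i * c $ j)"

lemma rank_one_mult_vector [simp]: "rank_one c *v x = (c \<bullet> x) *\<^sub>R c"
  by (simp add: rank_one_def matrix_vector_mult_def inner_vec_def vec_eq_iff sum_distrib_left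
      mult_ac)

lemma transpose_mat_minus_rank_one [simp]:
  "transpose (mat 1 - k *\<^sub>R rank_one c) = mat 1 - k *\<^sub>R rank_one c"
  by (simp add: rank_one_def transpose_def vec_eq_iff mat_def mult_ac)

text \<open>With \<open>s = norm c\<close>, this is the length of the plane vector
  \<open>(2, s)\<close> that normalises the rotation, and also the sum of the singular values of the
  shear \<open>[[1, s], [0, 1]]\<close>.\<close>

definition polar_radius :: "real^'n \<Rightarrow> real" where
  "polar_radius c = sqrt (4 + c \<bullet> c)"

text \<open>In the plane spanned by \<open>c\<close> and the last coordinate axis, the translation by \<open>c\<close> is the
  shear with matrix \<open>[[1, s], [0, 1]]\<close>, where \<open>s = norm c\<close>. Its polar factors are
  \<open>[[2, s], [-s, 2]] / r\<close> and \<open>[[2, s], [s, s\<^sup>2 + 2]] / r\<close> with \<open>r = sqrt (4 + s\<^sup>2)\<close>, and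
  \<open>(1 - 2 / r) / s\<^sup>2 = 1 / (r * (r + 2))\<close> is also meaningful for \<open>c = 0\<close>.\<close>

definition shear_rotation :: "real^'d \<Rightarrow> real^('d::finite + 1)^('d + 1)" where
  "shear_rotation c = block_matrix (mat 1 - (1 / (polar_radius c * (polar_radius c + 2))) *\<^sub>R rank_one c)
     (c /\<^sub>R polar_radius c) (- (c /\<^sub>R polar_radius c)) (2 / polar_radius c)"

definition shear_stretch :: "real^'d \<Rightarrow> real^('d::finite + 1)^('d + 1)" where
  "shear_stretch c = block_matrix (mat 1 - (1 / (polar_radius c * (polar_radius c + 2))) *\<^sub>R rank_one c)
     (c /\<^sub>R polar_radius c) (c /\<^sub>R polar_radius c) ((c \<bullet> c + 2) / polar_radius c)"

lemma polar_radius_pos: "polar_radius c > 0"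
  by (simp add: polar_radius_def add_pos_nonneg)

text \<open>Eliminates \<open>c \<bullet> c\<close>, so that the identities below become rational in
  the radius.\<close>

lemma inner_self_eq_polar_radius: "c \<bullet> c = (polar_radius c)\<^sup>2 - 4"
  by (simp add: polar_radius_def)

text \<open>Collecting the change of \<open>v\<close> into one multiple of \<open>c\<close> reduces
  matrix identities to two scalar equations.\<close>

lemma shear_rotation_mult_vector:
  "shear_rotation c *v block_vector v t =
     block_vector (v + ((t - c \<bullet> v / (polar_radius c + 2)) / polar_radius c) *\<^sub>R c) ((2 * t - c \<bullet> v) / polar_radius c)"
  using polar_radius_pos [of c]
  by (simp add: shear_rotation_def block_matrix_mult_vector block_vector_eq_iff
      matrix_vector_mult_diff_rdistrib scaleR_matrix_vector_assoc [symmetric] diff_divide_distrib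
      scaleR_left_diff_distrib divide_inverse algebra_simps)
     (simp add: distrib_left flip: inverse_mult_distrib)

text \<open>Reversing \<open>c\<close> reverses the angle of the plane rotation, so the transpose
  obeys the same action formula.\<close>

lemma transpose_shear_rotation: "transpose (shear_rotation c) = shear_rotation (- c)"
proof -
  have "polar_radius (- c) = polar_radius c" "rank_one (- c) = rank_one c"
    by (simp_all add: polar_radius_def rank_one_def)
  then show ?thesis
    by (simp add: shear_rotation_def transpose_block_matrix)
qed

lemma shear_stretch_mult_vector:
  "shear_stretch c *v block_vector v t =
     block_vector (v + ((t - c \<bullet> v / (polar_radius c + 2)) / polar_radius c) *\<^sub>R c)
       ((c \<bullet> v + (c \<bullet> c + 2) * t) / polar_radius c)"
  using polar_radius_pos [of c]
  by (simp add: shear_stretch_def block_matrix_mult_vector block_vector_eq_iff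
      matrix_vector_mult_diff_rdistrib scaleR_matrix_vector_assoc [symmetric] diff_divide_distrib
      scaleR_left_diff_distrib divide_inverse algebra_simps)
     (simp add: distrib_left flip: inverse_mult_distrib)

lemma orthogonal_shear_rotation: "orthogonal_matrix (shear_rotation c)"
  unfolding orthogonal_matrix
proof (rule matrix_eq_block_vectorI)
  fix v t
  define r where "r = polar_radius c"
  define p where "p = c \<bullet> v"
  have r: "r > 0" "c \<bullet> c = r\<^sup>2 - 4" "polar_radius (- c) = r"
    by (simp_all add: r_def polar_radius_pos inner_self_eq_polar_radius) (simp add: polar_radius_def)
  \<comment> \<open>The first application gives the components \<open>v + k *\<^sub>R c\<close> and
    \<open>u\<close>; \<open>q\<close> is the inner product of \<open>c\<close> with the former,
    needed for the second application.\<close>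
  define k where "k = (t - p / (r + 2)) / r"
  define u where "u = (2 * t - p) / r"
  define q where "q = p + k * (c \<bullet> c)"
  have "(transpose (shear_rotation c) ** shear_rotation c) *v block_vector v t =
      block_vector (v + (k - (u + q / (r + 2)) / r) *\<^sub>R c) ((2 * u + q) / r)"
    using r(3)
    by (simp add: transpose_shear_rotation shear_rotation_mult_vector inner_add_right
        matrix_vector_mul_assoc [symmetric] k_def p_def r_def u_def q_def block_vector_eq_iff
        scaleR_left_diff_distrib minus_divide_left del: divide_minus_left)
  moreover have "k - (u + q / (r + 2)) / r = 0"
    using r(1) by (simp add: k_def u_def q_def r(2) divide_simps)
      (simp add: algebra_simps power2_eq_square)
  moreover have "(2 * u + q) / r = t"
    using r(1) by (simp add: k_def u_def q_def r(2) divide_simps)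
      (simp add: algebra_simps power2_eq_square)
  ultimately show "(transpose (shear_rotation c) ** shear_rotation c) *v block_vector v t =
        mat 1 *v block_vector v t"
    by simp
qed

lemma shear_rotation_mult_stretch:
  "shear_rotation c ** shear_stretch c = homogeneous_matrix (mat 1) c"
proof (rule matrix_eq_block_vectorI)
  fix v t
  define r where "r = polar_radius c"
  define p where "p = c \<bullet> v"
  have r: "r > 0" "c \<bullet> c = r\<^sup>2 - 4"
    by (simp_all add: r_def polar_radius_pos inner_self_eq_polar_radius)
  \<comment> \<open>Here \<open>v + k *\<^sub>R c\<close> and \<open>u\<close> are the components
    after the stretch, with \<open>c \<bullet> c + 2\<close> written as
    \<open>r\<^sup>2 - 2\<close>, and \<open>q\<close> is the inner product of \<open>c\<close> with
    the former.\<close>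
  define k where "k = (t - p / (r + 2)) / r"
  define u where "u = (p + (r\<^sup>2 - 2) * t) / r"
  define q where "q = p + k * (r\<^sup>2 - 4)"
  have "(shear_rotation c ** shear_stretch c) *v block_vector v t =
      block_vector (v + (k + (u - q / (r + 2)) / r) *\<^sub>R c) ((2 * u - q) / r)"
    using r
    by (simp add: shear_rotation_mult_vector shear_stretch_mult_vector inner_add_right
        matrix_vector_mul_assoc [symmetric] k_def p_def r_def u_def q_def block_vector_eq_iff
        scaleR_left_distrib)
  moreover have "k + (u - q / (r + 2)) / r = t"
    using r(1) by (simp add: k_def u_def q_def divide_simps)
      (simp add: algebra_simps power2_eq_square)
  moreover have "(2 * u - q) / r = t"
    using r(1) by (simp add: k_def u_def q_def divide_simps)
      (simp add: algebra_simps power2_eq_square)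
  ultimately show "(shear_rotation c ** shear_stretch c) *v block_vector v t =
      homogeneous_matrix (mat 1) c *v block_vector v t"
    by (simp add: homogeneous_matrix_eq_block_matrix block_matrix_mult_vector)
qed

text \<open>After scaling by \<open>r * (r + 2)\<close>, the quadratic form is the Cauchy-Schwarz
  gap of \<open>c\<close> and \<open>v\<close> plus a positive multiple of a sum of squares.\<close>

lemma symmetric_positive_definite_shear_stretch:
  fixes c :: "real^'d"
  shows "symmetric_positive_definite (shear_stretch c)"
  unfolding symmetric_positive_definite_def
proof (intro conjI allI impI)
  show "transpose (shear_stretch c) = shear_stretch c"
    by (simp add: shear_stretch_def transpose_block_matrix)
  fix x :: "real^('d + 1)"
  assume "x \<noteq> 0"
  obtain v t where x: "x = block_vector v t"
    by (rule block_vector_cases)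
  define r where "r = polar_radius c"
  define p where "p = c \<bullet> v"
  have r: "r > 0" "c \<bullet> c = r\<^sup>2 - 4"
    by (simp_all add: r_def polar_radius_pos inner_self_eq_polar_radius)
  have "x \<bullet> (shear_stretch c *v x) =
      v \<bullet> v + (t - p / (r + 2)) / r * p + t * ((p + (r\<^sup>2 - 2) * t) / r)"
    using r by (simp add: x shear_stretch_mult_vector inner_block_vector inner_add_right r_def p_def
        inner_commute)
  then have "r * (r + 2) * (x \<bullet> (shear_stretch c *v x)) =
      r * (r + 2) * (v \<bullet> v + (t - p / (r + 2)) / r * p + t * ((p + (r\<^sup>2 - 2) * t) / r))"
    by (rule arg_cong)
  \<comment> \<open>The coefficient of \<open>v \<bullet> v\<close> splits as
    \<open>r * (r + 2) = (r\<^sup>2 - 4) + 2 * (r + 2)\<close>; its first part is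
    \<open>c \<bullet> c\<close>, as Cauchy-Schwarz requires.\<close>
  also have "\<dots> = ((c \<bullet> c) * (v \<bullet> v) - p\<^sup>2) +
      (r + 2) * (2 * (v \<bullet> v) + (2 * t * p + (c \<bullet> c + 2) * t\<^sup>2))"
    unfolding r(2) using r(1)
    by (simp add: divide_simps) (simp add: algebra_simps power2_eq_square)
  \<comment> \<open>One copy of \<open>v \<bullet> v\<close> completes the square; the other, with
    \<open>2 * t\<^sup>2\<close>, gives strict positivity.\<close>
  also have "2 * (v \<bullet> v) + (2 * t * p + (c \<bullet> c + 2) * t\<^sup>2) =
      v \<bullet> v + (v + t *\<^sub>R c) \<bullet> (v + t *\<^sub>R c) + 2 * t\<^sup>2"
    by (simp add: p_def inner_commute [of v c] algebra_simps power2_eq_square)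
  also have "(c \<bullet> c) * (v \<bullet> v) - p\<^sup>2 + (r + 2) * \<dots> > 0"
  proof (rule add_nonneg_pos)
    show "0 \<le> (c \<bullet> c) * (v \<bullet> v) - p\<^sup>2"
      using Cauchy_Schwarz_ineq [of c v] by (simp add: p_def)
    have "v \<bullet> v > 0 \<or> t\<^sup>2 > 0"
      using \<open>x \<noteq> 0\<close> by (simp add: x block_vector_eq_0_iff)
    then have "0 < v \<bullet> v + (v + t *\<^sub>R c) \<bullet> (v + t *\<^sub>R c) + 2 * t\<^sup>2"
      using inner_ge_zero [of v] inner_ge_zero [of "v + t *\<^sub>R c"] zero_le_power2 [of t]
      by linarith
    then show "0 < (r + 2) * (v \<bullet> v + (v + t *\<^sub>R c) \<bullet> (v + t *\<^sub>R c) + 2 * t\<^sup>2)"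
      using r(1) by simp
  qed
  finally show "x \<bullet> (shear_stretch c *v x) > 0"
    by (rule zero_less_mult_pos) (use r(1) in simp)
qed

lemma polar_decomposition_shear:
  "polar_decomposition (homogeneous_matrix (mat 1) c) (shear_rotation c) (shear_stretch c)"
  by (simp add: polar_decomposition_def orthogonal_shear_rotation shear_rotation_mult_stretch
      symmetric_positive_definite_shear_stretch)

section \<open>The polar factor of a rigid motion and its injectivity\<close>

lemma polar_decomposition_homogeneous_matrix:
  assumes "orthogonal_matrix R"
  shows "\<exists>H. polar_decomposition (homogeneous_matrix R c)
               (shear_rotation c ** homogeneous_matrix R 0) H"
proof -
  have "homogeneous_matrix R c = homogeneous_matrix (mat 1) c ** homogeneous_matrix R 0"
    by (simp add: homogeneous_matrix_mult)
  then show ?thesis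
    using polar_decomposition_mult_orthogonal [OF polar_decomposition_shear
        orthogonal_homogeneous_matrix [OF assms]] by metis
qed

lemma shear_rotation_mult_homogeneous_inject:
  assumes "shear_rotation c ** homogeneous_matrix R 0 = shear_rotation c' ** homogeneous_matrix R' 0"
  shows "c = c' \<and> R = R'"
proof -
  have last: "(shear_rotation c ** homogeneous_matrix R 0) *v block_vector 0 1 =
      block_vector (c /\<^sub>R polar_radius c) (2 / polar_radius c)" for c and R :: "real^'a^'a"
    by (simp add: shear_rotation_def homogeneous_matrix_eq_block_matrix block_matrix_mult_vector
        matrix_vector_mul_assoc [symmetric])
  have "block_vector (c /\<^sub>R polar_radius c) (2 / polar_radius c) = block_vector (c' /\<^sub>R polar_radius c') (2 / polar_radius c')"
    by (metis assms last)
  \<comment> \<open>The last entries give equal radii, and then the upper blocks give equal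
    vectors.\<close>
  then have "c = c'"
    using polar_radius_pos [of c] polar_radius_pos [of c'] by (auto simp: block_vector_eq_iff)
  moreover from this have "homogeneous_matrix R 0 = homogeneous_matrix R' 0"
    using assms orthogonal_shear_rotation [of c]
    by (metis matrix_mul_assoc matrix_mul_lid orthogonal_matrix)
  then have "R = R'"
    by (metis linear_part_homogeneous_matrix)
  ultimately show ?thesis
    by simp
qed

theorem corollary3p3:
  fixes lam :: real
  assumes "lam \<ge> 1"
  shows "polar_map lam \<in> (special_euclidean_group :: (real^('d::finite + 1)^('d + 1)) set)
           \<rightarrow> special_orthogonal_group
       \<and> inj_on (polar_map lam) (special_euclidean_group :: (real^('d + 1)^('d + 1)) set)"
proof -
  have polar: "\<exists>H. polar_decomposition (homogeneous_matrix \<mu> (b /\<^sub>R lam))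
      (shear_rotation (b /\<^sub>R lam) ** homogeneous_matrix \<mu> 0) H"
    if "\<mu> \<in> special_orthogonal_group" for \<mu> :: "real^'d^'d" and b
    using that polar_decomposition_homogeneous_matrix
    by (auto simp: special_orthogonal_group_def rotation_matrix_def)
  have factor: "polar_map lam (homogeneous_matrix \<mu> b) =
      shear_rotation (b /\<^sub>R lam) ** homogeneous_matrix \<mu> 0"
    if "\<mu> \<in> special_orthogonal_group" for \<mu> :: "real^'d^'d" and b
    using polar [OF that]
    by (auto simp: polar_map_def scaled_motion_def intro: orthogonal_polar_factor_eqI)
  show ?thesis
  proof (intro conjI funcsetI inj_onI)
    fix g :: "real^('d + 1)^('d + 1)"
    assume "g \<in> special_euclidean_group"
    then obtain \<mu> :: "real^'d^'d" and b
      where g: "g = homogeneous_matrix \<mu> b" "\<mu> \<in> special_orthogonal_group"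
      by (auto simp: special_euclidean_group_def)
    \<comment> \<open>Positivity of the determinant makes the orthogonal factor a rotation.\<close>
    then have "det (homogeneous_matrix \<mu> (b /\<^sub>R lam)) > 0"
      by (auto simp: special_orthogonal_group_def rotation_matrix_def
          intro: det_homogeneous_matrix_pos)
    then show "polar_map lam g \<in> special_orthogonal_group"
      using polar [OF g(2), of b] unfolding g(1) factor [OF g(2)]
      by (auto simp: special_orthogonal_group_def intro: polar_decomposition_rotation_matrix)
  next
    fix g h :: "real^('d + 1)^('d + 1)"
    assume "g \<in> special_euclidean_group" "h \<in> special_euclidean_group"
      and eq: "polar_map lam g = polar_map lam h"
    then obtain \<mu> \<nu> :: "real^'d^'d" and b c
      where g: "g = homogeneous_matrix \<mu> b" "\<mu> \<in> special_orthogonal_group"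
        and h: "h = homogeneous_matrix \<nu> c" "\<nu> \<in> special_orthogonal_group"
      by (auto simp: special_euclidean_group_def)
    have "b /\<^sub>R lam = c /\<^sub>R lam \<and> \<mu> = \<nu>"
      using eq unfolding g(1) h(1) factor [OF g(2)] factor [OF h(2)]
      by (rule shear_rotation_mult_homogeneous_inject)
    \<comment> \<open>Since \<open>lam \<ge> 1\<close>, the scaling is by a nonzero factor and
      cancels.\<close>
    then show "g = h"
      using assms g h by simp
  qed
qed

end
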